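(* Let $G$ be a finite tree. Then the graph correlahedron of $G$ is combinatorially the graph cubeahedron of the line graph $L(G)$: under the correspondence sending the edge pole $y_e$ to the square tube $\{e\}$ of $L(G)$ and the partial-energy pole $X_I$ to the round tube $I$ of $L(G)$, two facets of the graph correlahedron of $G$ are compatible if and only if the corresponding tubes of $L(G)$ are compatible.
   Context: Let $\mathcal B(G)$ be the collection of nonempty edge subsets $I\subseteq E(G)$ such that the subgraph $G[I]$ (edge set $I$ together with all endpoints) is connected. The graph correlahedron of the tree $G$ has facets labelled by the edge poles $y_e$, $e\in E(G)$, and the partial-energy poles $X_I$, $I\in\mathcal B(G)$ (including $I=E(G)$); its combinatorics is determined by pairwise compatibility: $X_I$ and $X_J$ are compatible iff one of $G[I],G[J]$ contains the other or they share neither vertices nor edges; $y_e$ and $y_f$ ($e\ne f$) are always compatible; $y_e$ and $X_I$ are compatible iff $e\notin I$. The line graph $L(G)$ has one vertex for each edge of $G$, two being adjacent iff the corresponding edges of $G$ share an endpoint. For a graph $L$, the graph cubeahedron has facets labelled by round tubes (nonempty vertex subsets, not necessarily proper, inducing a connected subgraph of $L$) and square tubes (single vertices of $L$); its combinatorics is determined by pairwise compatibility: two round tubes are compatible iff one contains the other or they are disjoint and no edge of $L$ joins them; two distinct square tubes are always compatible; a square tube and a round tube are compatible iff the square tube's vertex is not contained in the round tube. *)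

theory Defs
  imports Main
begin

record 'a ugraph =
  verts :: "'a set"
  edges :: "'a set set"

definition simple_graph :: "'a ugraph \<Rightarrow> bool" where
  "simple_graph G \<longleftrightarrow> (\<forall>e\<in>edges G. e \<subseteq> verts G \<and> card e = 2)"

definition adj_rel :: "'a ugraph \<Rightarrow> 'a rel" where
  "adj_rel G = {(u, v). {u, v} \<in> edges G}"

definition connected_graph :: "'a ugraph \<Rightarrow> bool" where
  "connected_graph G \<longleftrightarrow>
     verts G \<noteq> {} \<and> (\<forall>u\<in>verts G. \<forall>v\<in>verts G. (u, v) \<in> (adj_rel G)\<^sup>*)"

definition is_cycle :: "'a ugraph \<Rightarrow> 'a list \<Rightarrow> bool" where
  "is_cycle G c \<longleftrightarrow> length c \<ge> 3 \<and> distinct c \<and>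
     (\<forall>i<length c. {c ! i, c ! (Suc i mod length c)} \<in> edges G)"

definition finite_tree :: "'a ugraph \<Rightarrow> bool" where
  "finite_tree G \<longleftrightarrow> simple_graph G \<and> finite (verts G) \<and> connected_graph G \<and>
     (\<nexists>c. is_cycle G c)"

definition edge_subgraph :: "'a set set \<Rightarrow> 'a ugraph" where
  "edge_subgraph I = \<lparr>verts = \<Union>I, edges = I\<rparr>"

definition induced_subgraph :: "'a ugraph \<Rightarrow> 'a set \<Rightarrow> 'a ugraph" where
  "induced_subgraph L S = \<lparr>verts = S, edges = {e \<in> edges L. e \<subseteq> S}\<rparr>"

definition subgraph :: "'a ugraph \<Rightarrow> 'a ugraph \<Rightarrow> bool" where
  "subgraph H K \<longleftrightarrow> verts H \<subseteq> verts K \<and> edges H \<subseteq> edges K"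

definition line_graph :: "'a ugraph \<Rightarrow> 'a set ugraph" where
  "line_graph G = \<lparr>verts = edges G,
     edges = {{e, f} | e f. e \<in> edges G \<and> f \<in> edges G \<and> e \<noteq> f \<and> e \<inter> f \<noteq> {}}\<rparr>"


definition connected_edge_sets :: "'a ugraph \<Rightarrow> 'a set set set" where
  "connected_edge_sets G =
     {I. I \<subseteq> edges G \<and> I \<noteq> {} \<and> connected_graph (edge_subgraph I)}"

datatype 'e pole = EdgePole 'e | EnergyPole "'e set"

definition correlahedron_facets :: "'a ugraph \<Rightarrow> 'a set pole set" where
  "correlahedron_facets G = EdgePole ` edges G \<union> EnergyPole ` connected_edge_sets G"

text \<open>In both compatibility relations below, every facet counts as compatible with itself;
  only pairs of distinct facets matter for the faces.\<close>

fun pole_compat :: "'a set pole \<Rightarrow> 'a set pole \<Rightarrow> bool" where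
  "pole_compat (EnergyPole I) (EnergyPole J) \<longleftrightarrow>
     subgraph (edge_subgraph I) (edge_subgraph J) \<or>
     subgraph (edge_subgraph J) (edge_subgraph I) \<or>
     (verts (edge_subgraph I) \<inter> verts (edge_subgraph J) = {} \<and>
      edges (edge_subgraph I) \<inter> edges (edge_subgraph J) = {})"
| "pole_compat (EdgePole e) (EdgePole f) \<longleftrightarrow> True"
| "pole_compat (EdgePole e) (EnergyPole I) \<longleftrightarrow> e \<notin> I"
| "pole_compat (EnergyPole I) (EdgePole e) \<longleftrightarrow> e \<notin> I"

text \<open>A face is encoded by the set of facets containing it; the empty set encodes the
  whole polytope.\<close>

definition correlahedron_faces :: "'a ugraph \<Rightarrow> 'a set pole set set" where
  "correlahedron_faces G = {F. F \<subseteq> correlahedron_facets G \<and> pairwise pole_compat F}"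


datatype 'a tube = SquareTube 'a | RoundTube "'a set"

definition round_tubes :: "'a ugraph \<Rightarrow> 'a set set" where
  "round_tubes L =
     {S. S \<subseteq> verts L \<and> S \<noteq> {} \<and> connected_graph (induced_subgraph L S)}"

definition cubeahedron_facets :: "'a ugraph \<Rightarrow> 'a tube set" where
  "cubeahedron_facets L = SquareTube ` verts L \<union> RoundTube ` round_tubes L"

fun tube_compat :: "'a ugraph \<Rightarrow> 'a tube \<Rightarrow> 'a tube \<Rightarrow> bool" where
  "tube_compat L (RoundTube S) (RoundTube T) \<longleftrightarrow>
     S \<subseteq> T \<or> T \<subseteq> S \<or>
     (S \<inter> T = {} \<and> \<not> (\<exists>u\<in>S. \<exists>v\<in>T. {u, v} \<in> edges L))"
| "tube_compat L (SquareTube u) (SquareTube v) \<longleftrightarrow> True"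
| "tube_compat L (SquareTube u) (RoundTube S) \<longleftrightarrow> u \<notin> S"
| "tube_compat L (RoundTube S) (SquareTube u) \<longleftrightarrow> u \<notin> S"

definition cubeahedron_faces :: "'a ugraph \<Rightarrow> 'a tube set set" where
  "cubeahedron_faces L = {F. F \<subseteq> cubeahedron_facets L \<and> pairwise (tube_compat L) F}"


fun pole_to_tube :: "'e pole \<Rightarrow> 'e tube" where
  "pole_to_tube (EdgePole e) = SquareTube e"
| "pole_to_tube (EnergyPole I) = RoundTube I"

end

theory Submission
  imports Defs
begin

text \<open>Edges of \<open>G\<close> are the vertices of \<open>L(G)\<close>, so square tubes are
  exactly the edge poles. A walk in \<open>G[I]\<close> runs through edges of which consecutive ones
  share an endpoint, hence gives a walk in \<open>L(G)[I]\<close>; conversely, a walk in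
  \<open>L(G)[I]\<close> can be followed through shared endpoints. So \<open>G[I]\<close> is
  connected iff \<open>L(G)[I]\<close> is (\<open>connected_edge_subgraph_iff\<close>), and energy
  poles are exactly the round tubes. For compatibility, containment of \<open>G[I]\<close> in
  \<open>G[J]\<close> amounts to containment of the edge sets, and for disjoint \<open>I\<close>,
  \<open>J\<close> a common vertex of \<open>G[I]\<close> and \<open>G[J]\<close> is the same as an
  edge of \<open>L(G)\<close> joining \<open>I\<close> to \<open>J\<close>
  (\<open>pole_compat_iff_tube_compat\<close>). Faces are sets of pairwise compatible facets, so the
  bijection of facets carries over to them.\<close>

lemma line_graph_simps [simp]:
  "verts (line_graph G) = edges G"
  "{e, f} \<in> edges (line_graph G) \<longleftrightarrow> e \<in> edges G \<and> f \<in> edges G \<and> e \<noteq> f \<and> e \<inter> f \<noteq> {}"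
  by (auto simp: line_graph_def doubleton_eq_iff)

lemma adj_rel_edge_subgraph: "(u, v) \<in> adj_rel (edge_subgraph I) \<longleftrightarrow> {u, v} \<in> I"
  by (simp add: adj_rel_def edge_subgraph_def)

lemma adj_rel_induced_line_graph:
  "(e, f) \<in> adj_rel (induced_subgraph (line_graph G) I) \<longleftrightarrow>
     e \<in> edges G \<inter> I \<and> f \<in> edges G \<inter> I \<and> e \<noteq> f \<and> e \<inter> f \<noteq> {}"
  by (auto simp: adj_rel_def induced_subgraph_def)

text \<open>Induction on the walk with \<open>f\<close> arbitrary: before a last step from
  \<open>y\<close> to \<open>z\<close>, the hypothesis is applied to the edge \<open>{y, z}\<close>,
  which meets \<open>f\<close> in \<open>z\<close>.\<close>

lemma line_graph_walk_of_walk: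
  assumes I: "I \<subseteq> edges G" and e: "e \<in> I" "u \<in> e"
    and walk: "(u, v) \<in> (adj_rel (edge_subgraph I))\<^sup>*"
    and f: "f \<in> I" "v \<in> f"
  shows "(e, f) \<in> (adj_rel (induced_subgraph (line_graph G) I))\<^sup>*"
proof -
  let ?L = "adj_rel (induced_subgraph (line_graph G) I)"
  \<comment> \<open>The line graph has no loops, so \<open>g = h\<close> is covered by the empty
    walk.\<close>
  have meet: "(g, h) \<in> ?L\<^sup>*" if "g \<in> I" "h \<in> I" "x \<in> g" "x \<in> h" for g h x
  proof (cases "g = h")
    case False
    then have "(g, h) \<in> ?L"
      using that I by (auto simp: adj_rel_induced_line_graph)
    then show ?thesis by blast
  qed simp
  show ?thesis
    using walk f
  proof (induction arbitrary: f rule: rtrancl_induct)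
    case base
    then show ?case using meet e by blast
  next
    case (step y z)
    have yz: "{y, z} \<in> I"
      using step.hyps(2) by (simp add: adj_rel_edge_subgraph)
    then have "(e, {y, z}) \<in> ?L\<^sup>*" by (rule step.IH) simp
    moreover have "({y, z}, f) \<in> ?L\<^sup>*" using meet[OF yz, of f z] step.prems by simp
    ultimately show ?case by (rule rtrancl_trans)
  qed
qed

text \<open>Consecutive edges \<open>g\<close>, \<open>h\<close> share a vertex \<open>w\<close>;
  one walks to \<open>w\<close> and then, inside \<open>h\<close>, takes at most one more
  step.\<close>

lemma walk_of_line_graph_walk:
  assumes two: "\<forall>e\<in>I. card e = 2" and e: "e \<in> I" "u \<in> e"
    and walk: "(e, f) \<in> (adj_rel (induced_subgraph (line_graph G) I))\<^sup>*"
    and v: "v \<in> f"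
  shows "(u, v) \<in> (adj_rel (edge_subgraph I))\<^sup>*"
proof -
  let ?A = "adj_rel (edge_subgraph I)"
  have ends: "(x, y) \<in> ?A\<^sup>*" if g: "g \<in> I" "x \<in> g" "y \<in> g" for g x y
  proof (cases "x = y")
    case False
    have "card g = 2" using two g(1) by blast
    then have "g = {x, y}" using g False by (auto simp: card_2_iff)
    then show ?thesis using g by (auto simp: adj_rel_edge_subgraph)
  qed simp
  show ?thesis
    using walk v
  proof (induction arbitrary: v rule: rtrancl_induct)
    case base
    then show ?case using ends e by blast
  next
    case (step g h)
    then obtain w where w: "w \<in> g" "w \<in> h" and h: "h \<in> I"
      by (auto simp: adj_rel_induced_line_graph)
    have "(u, w) \<in> ?A\<^sup>*" using w(1) by (rule step.IH)
    moreover have "(w, v) \<in> ?A\<^sup>*" using ends h w(2) step.prems by blast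
    ultimately show ?case by (rule rtrancl_trans)
  qed
qed

lemma connected_edge_subgraph_iff:
  assumes simple: "simple_graph G" and I: "I \<subseteq> edges G" "I \<noteq> {}"
  shows "connected_graph (edge_subgraph I) \<longleftrightarrow>
    connected_graph (induced_subgraph (line_graph G) I)"
proof
  have two: "\<forall>e\<in>I. card e = 2"
    using simple I(1) by (auto simp: simple_graph_def)
  \<comment> \<open>Nonempty edges supply endpoints to walk between in one direction and a nonempty
    vertex set in the other.\<close>
  then have ne: "e \<noteq> {}" if "e \<in> I" for e using that by fastforce
  show "connected_graph (induced_subgraph (line_graph G) I)"
    if conn: "connected_graph (edge_subgraph I)"
  proof -
    have "(e, f) \<in> (adj_rel (induced_subgraph (line_graph G) I))\<^sup>*"
      if ef: "e \<in> I" "f \<in> I" for e f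
    proof -
      obtain u v where uv: "u \<in> e" "v \<in> f" using ne ef by blast
      then have "(u, v) \<in> (adj_rel (edge_subgraph I))\<^sup>*"
        using conn ef by (auto simp: connected_graph_def edge_subgraph_def)
      then show ?thesis using line_graph_walk_of_walk I(1) ef uv by metis
    qed
    then show ?thesis using I(2) by (simp add: connected_graph_def induced_subgraph_def)
  qed
  show "connected_graph (edge_subgraph I)"
    if conn: "connected_graph (induced_subgraph (line_graph G) I)"
  proof -
    have "(u, v) \<in> (adj_rel (edge_subgraph I))\<^sup>*" if "u \<in> \<Union>I" "v \<in> \<Union>I" for u v
    proof -
      obtain e f where ef: "e \<in> I" "u \<in> e" "f \<in> I" "v \<in> f" using \<open>u \<in> \<Union>I\<close> \<open>v \<in> \<Union>I\<close> by blast
      then have "(e, f) \<in> (adj_rel (induced_subgraph (line_graph G) I))\<^sup>*"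
        using conn by (auto simp: connected_graph_def induced_subgraph_def)
      then show ?thesis using walk_of_line_graph_walk two ef by metis
    qed
    moreover have "\<Union>I \<noteq> {}" using I(2) ne by blast
    ultimately show ?thesis by (simp add: connected_graph_def edge_subgraph_def)
  qed
qed

lemma round_tubes_line_graph:
  assumes "simple_graph G"
  shows "round_tubes (line_graph G) = connected_edge_sets G"
  using connected_edge_subgraph_iff[OF assms]
  by (auto simp: round_tubes_def connected_edge_sets_def)

lemma inj_pole_to_tube: "inj pole_to_tube"
proof (rule injI)
  fix a b :: "'e pole"
  assume "pole_to_tube a = pole_to_tube b"
  then show "a = b" by (cases a; cases b) auto
qed

lemma pole_to_tube_image_facets:
  assumes "simple_graph G"
  shows "pole_to_tube ` correlahedron_facets G = cubeahedron_facets (line_graph G)"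
  by (simp add: correlahedron_facets_def cubeahedron_facets_def image_Un image_image
      round_tubes_line_graph[OF assms])

lemma pole_compat_iff_tube_compat:
  assumes "a \<in> correlahedron_facets G" "b \<in> correlahedron_facets G"
  shows "pole_compat a b \<longleftrightarrow> tube_compat (line_graph G) (pole_to_tube a) (pole_to_tube b)"
proof -
  have energy: "pole_compat (EnergyPole I) (EnergyPole J) \<longleftrightarrow>
      tube_compat (line_graph G) (RoundTube I) (RoundTube J)"
    if "I \<subseteq> edges G" "J \<subseteq> edges G" for I J
  proof -
    have "subgraph (edge_subgraph A) (edge_subgraph B) \<longleftrightarrow> A \<subseteq> B" for A B :: "'a set set"
      by (auto simp: subgraph_def edge_subgraph_def)
    \<comment> \<open>Disjointness of \<open>I\<close> and \<open>J\<close> yields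
      \<open>e \<noteq> f\<close>, which adjacency in the line graph demands.\<close>
    moreover have "{e, f} \<in> edges (line_graph G) \<longleftrightarrow> e \<inter> f \<noteq> {}"
      if "I \<inter> J = {}" "e \<in> I" "f \<in> J" for e f
      using that \<open>I \<subseteq> edges G\<close> \<open>J \<subseteq> edges G\<close> by auto
    then have "\<Union>I \<inter> \<Union>J = {} \<and> I \<inter> J = {} \<longleftrightarrow>
        I \<inter> J = {} \<and> \<not> (\<exists>e\<in>I. \<exists>f\<in>J. {e, f} \<in> edges (line_graph G))"
      by blast
    ultimately show ?thesis by (simp add: edge_subgraph_def)
  qed
  show ?thesis
    using assms energy
    \<comment> \<open>The two energy-energy equations stay folded so that \<open>energy\<close>
      applies to them as stated.\<close>
    by (cases a; cases b) (auto simp: correlahedron_facets_def connected_edge_sets_def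
        simp del: pole_compat.simps(1) tube_compat.simps(1))
qed

lemma pole_to_tube_image_faces:
  assumes "simple_graph G"
  shows "(`) pole_to_tube ` correlahedron_faces G = cubeahedron_faces (line_graph G)"
proof -
  let ?L = "line_graph G"
  \<comment> \<open>\<open>pairwise\<close> tests distinct elements only, so injectivity is what
    matches the tested pairs on both sides.\<close>
  have pairwise_iff: "pairwise (tube_compat ?L) (pole_to_tube ` F) \<longleftrightarrow> pairwise pole_compat F"
    if "F \<subseteq> correlahedron_facets G" for F
    using that pole_compat_iff_tube_compat[of _ G]
    by (simp add: pairwise_def inj_eq[OF inj_pole_to_tube] subset_iff)
  \<comment> \<open>Every set of tubes is the image of a set of poles, because the facets of the
    cubeahedron are the image of those of the correlahedron.\<close>
  have "cubeahedron_faces ?L =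
      {pole_to_tube ` F | F. F \<subseteq> correlahedron_facets G \<and> pairwise (tube_compat ?L) (pole_to_tube ` F)}"
    unfolding cubeahedron_faces_def pole_to_tube_image_facets[OF assms, symmetric]
    by (auto simp: subset_image_iff)
  also have "\<dots> = (`) pole_to_tube ` correlahedron_faces G"
    using pairwise_iff by (auto simp: correlahedron_faces_def)
  finally show ?thesis ..
qed

theorem mainTheorem13:
  fixes G :: "'v ugraph"
  assumes "finite_tree G"
  shows "bij_betw pole_to_tube (correlahedron_facets G) (cubeahedron_facets (line_graph G))
    \<and> (\<forall>a\<in>correlahedron_facets G. \<forall>b\<in>correlahedron_facets G.
         pole_compat a b \<longleftrightarrow> tube_compat (line_graph G) (pole_to_tube a) (pole_to_tube b))
    \<and> bij_betw (\<lambda>F. pole_to_tube ` F) (correlahedron_faces G) (cubeahedron_faces (line_graph G))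
    \<and> (\<forall>F\<in>correlahedron_faces G. \<forall>F'\<in>correlahedron_faces G.
         F \<subseteq> F' \<longleftrightarrow> pole_to_tube ` F \<subseteq> pole_to_tube ` F')"
proof -
  have simple: "simple_graph G" using assms by (simp add: finite_tree_def)
  have "bij_betw pole_to_tube (correlahedron_facets G) (cubeahedron_facets (line_graph G))"
    using pole_to_tube_image_facets[OF simple] inj_pole_to_tube
    by (auto simp: bij_betw_def intro: inj_on_subset)
  moreover have "bij_betw (\<lambda>F. pole_to_tube ` F) (correlahedron_faces G) (cubeahedron_faces (line_graph G))"
    using pole_to_tube_image_faces[OF simple]
    by (simp add: bij_betw_def inj_on_def inj_image_eq_iff[OF inj_pole_to_tube])
  ultimately show ?thesis
    using pole_compat_iff_tube_compat[of _ G] by (simp add: inj_image_subset_iff[OF inj_pole_to_tube])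
qed

end
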